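(* Fix an integer $k \geq 3$ and $\varepsilon \in (0,1)$ satisfying $\varepsilon < (k-2)/4$. There exists a set $F \subset \mathbb{R}$ which does not contain any $(k,\varepsilon)$-APs and which satisfies $$\dim_{\mathrm{A}} F = \dim_{\mathrm{H}} F = \frac{\log 2}{\log \frac{2k-2-4\varepsilon}{k-2-4\varepsilon}}.$$
   Context: An arithmetic progression of length $k$ with gap length $\Delta>0$ is a collection $\{a_i\}_{i=0}^{k-1} \subset \mathbb{R}$ with $a_i = a_0 + i\Delta$ for $i=1,\dots,k-1$. For $\varepsilon \geq 0$, a collection of points $\{b_i\}_{i=0}^{k-1} \subset \mathbb{R}$ is a $(k,\varepsilon)$-AP if there exists an arithmetic progression $\{a_i\}_{i=0}^{k-1}$ with some gap length $\Delta>0$ such that $|a_i - b_i| \leq \varepsilon \Delta$ for all $i = 0,1,\dots,k-1$. A set $F$ contains a $(k,\varepsilon)$-AP if there is a $(k,\varepsilon)$-AP $\{b_i\}_{i=0}^{k-1}$ with $b_i \in F$ for all $i$. $\dim_{\mathrm{H}}$ denotes Hausdorff dimension. For a non-empty bounded set $E \subset \mathbb{R}^d$ and $r>0$, $N(E,r)$ denotes the smallest number of open sets of diameter at most $r$ required to cover $E$. The Assouad dimension of a non-empty set $F \subseteq \mathbb{R}^d$ is $$\dim_{\mathrm{A}} F = \inf\left\{ s \geq 0 : (\exists C>0)(\forall R>0)(\forall r \in (0,R))(\forall x \in F)\ N(B(x,R)\cap F, r) \leq C \left(\frac{R}{r}\right)^s \right\},$$ where $B(x,R)$ is the closed ball with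 centre $x$ and radius $R$. *)

theory Defs
  imports "HOL-Analysis.Analysis"
begin

text \<open>
  Finite collections indexed by \<open>0, \<dots>, k - 1\<close> are functions on \<^typ>\<open>nat\<close> of which only the
  values below \<open>k\<close> matter; the points need not be distinct.
\<close>

definition arith_prog :: "nat \<Rightarrow> real \<Rightarrow> (nat \<Rightarrow> real) \<Rightarrow> bool" where
  "arith_prog k \<Delta> a \<longleftrightarrow> \<Delta> > 0 \<and> (\<forall>i<k. a i = a 0 + real i * \<Delta>)"

definition approx_AP :: "nat \<Rightarrow> real \<Rightarrow> (nat \<Rightarrow> real) \<Rightarrow> bool" where
  "approx_AP k \<epsilon> b \<longleftrightarrow> (\<exists>a \<Delta>. arith_prog k \<Delta> a \<and> (\<forall>i<k. \<bar>a i - b i\<bar> \<le> \<epsilon> * \<Delta>))"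

definition contains_approx_AP :: "real set \<Rightarrow> nat \<Rightarrow> real \<Rightarrow> bool" where
  "contains_approx_AP F k \<epsilon> \<longleftrightarrow> (\<exists>b. approx_AP k \<epsilon> b \<and> (\<forall>i<k. b i \<in> F))"

text \<open>
  The summand \<open>|U|\<^sup>s\<close> of Hausdorff measure, with the usual conventions \<open>|{}|\<^sup>s = 0\<close> for every \<open>s \<ge> 0\<close>
  and \<open>|U|\<^sup>0 = 1\<close> for nonempty \<open>U\<close>; they need a case distinction because \<open>0 powr 0 = 0\<close>.
\<close>

definition diam_power :: "real \<Rightarrow> 'a::metric_space set \<Rightarrow> real" where
  "diam_power s U = (if U = {} then 0 else if s = 0 then 1 else diameter U powr s)"

text \<open>
  Countable covers are sequences of sets; since \<open>{}\<close> is allowed and contributes 0, this includes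
  finite covers. Boundedness is required explicitly here and in the covering numbers below because
  \<^const>\<open>diameter\<close> is a real number, unspecified on unbounded sets.
\<close>

definition delta_cover :: "real \<Rightarrow> 'a::metric_space set \<Rightarrow> (nat \<Rightarrow> 'a set) \<Rightarrow> bool" where
  "delta_cover \<delta> F U \<longleftrightarrow> F \<subseteq> (\<Union>i. U i) \<and> (\<forall>i. bounded (U i) \<and> diameter (U i) \<le> \<delta>)"

definition hausdorff_premeasure :: "real \<Rightarrow> real \<Rightarrow> 'a::metric_space set \<Rightarrow> ennreal" where
  "hausdorff_premeasure s \<delta> F = (INF U\<in>{U. delta_cover \<delta> F U}. \<Sum>i. ennreal (diam_power s (U i)))"

text \<open>The limit as \<open>\<delta> \<rightarrow> 0\<close> is a supremum, the premeasures being antitone in \<open>\<delta>\<close>.\<close>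

definition hausdorff_measure :: "real \<Rightarrow> 'a::metric_space set \<Rightarrow> ennreal" where
  "hausdorff_measure s F = (SUP \<delta>\<in>{0<..}. hausdorff_premeasure s \<delta> F)"

definition hausdorff_dim :: "'a::metric_space set \<Rightarrow> ereal" where
  "hausdorff_dim F = Inf {ereal s |s. 0 \<le> s \<and> hausdorff_measure s F = 0}"

text \<open>
  Intended for bounded \<open>E\<close> and \<open>r > 0\<close>; then a finite cover exists, as the ambient space is Euclidean.
\<close>

definition covering_number :: "'a::euclidean_space set \<Rightarrow> real \<Rightarrow> nat" where
  "covering_number E r =
     (LEAST n. \<exists>\<U>. finite \<U> \<and> card \<U> = n \<and> E \<subseteq> \<Union>\<U> \<and>
                  (\<forall>U\<in>\<U>. open U \<and> bounded U \<and> diameter U \<le> r))"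

definition assouad_dim :: "'a::euclidean_space set \<Rightarrow> ereal" where
  "assouad_dim F =
     Inf {ereal s |s. 0 \<le> s \<and>
       (\<exists>C>0. \<forall>R>0. \<forall>r. 0 < r \<and> r < R \<longrightarrow>
          (\<forall>x\<in>F. real (covering_number (cball x R \<inter> F) r) \<le> C * (R / r) powr s))}"

end

(* Let F be the attractor of x -> rho x and x -> 1 - rho + rho x, where rho < 1/2 is chosen so that
   the central gap 1 - 2 rho equals (1 + 2 eps) / (k - 1 - 2 eps), with the right endpoint of every
   cylinder removed. Rescaling, an approximate progression in F may be assumed to meet both halves.
   It lies in [0, 1), so its gap length Delta satisfies (k - 1 - 2 eps) Delta < 1, and two consecutive
   points differ by at most (1 + 2 eps) Delta, which is too short to cross the gap. For the closed
   Cantor set the inequalities would not be strict, and for k = 4 it does contain such a progression.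

   Removing the right endpoints amounts to parametrising F by [0, 1) through binary expansions. The
   inverse of this parametrisation is Hoelder continuous with exponent s = ln 2 / ln (1 / rho), so
   Lebesgue measure on [0, 1) bounds the s-mass of any cover of F from below; this takes the place of
   a mass distribution. Covers by dyadic cylinders give the upper bounds. *)
theory Submission
  imports Defs
begin

section \<open>Finite covers: as sequences, in premeasures and in covering numbers\<close>

text \<open>An injective enumeration padded with \<open>{}\<close> does this. It lets finite covers
  enter statements about countable ones, for every set function \<open>h\<close> that ignores the
  padding.\<close>

lemma finite_cover_sequence:
  fixes \<U> :: "'a set set"
  assumes "finite \<U>"
  obtains U :: "nat \<Rightarrow> 'a set" where "(\<Union>i. U i) = \<Union>\<U>" "\<And>i. U i \<in> insert {} \<U>"
    "\<And>h :: 'a set \<Rightarrow> ennreal. h {} = 0 \<Longrightarrow> (\<Sum>i. h (U i)) = sum h \<U>"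
proof -
  obtain f where f: "bij_betw f {..<card \<U>} \<U>"
    using ex_bij_betw_nat_finite[OF assms] by (auto simp: atLeast0LessThan)
  define U where "U i = (if i < card \<U> then f i else {})" for i
  have im: "f ` {..<card \<U>} = \<U>" using f by (simp add: bij_betw_def)
  show ?thesis
  proof (rule that[of U])
    show "(\<Union>i. U i) = \<Union>\<U>"
      by (subst im[symmetric]) (auto simp: U_def split: if_splits)
    show "U i \<in> insert {} \<U>" for i using im by (auto simp: U_def)
    show "(\<Sum>i. h (U i)) = sum h \<U>" if "h {} = 0" for h :: "'a set \<Rightarrow> ennreal"
    proof -
      have "(\<Sum>i. h (U i)) = (\<Sum>i<card \<U>. h (U i))"
        using that by (intro suminf_finite) (auto simp: U_def)
      also have "\<dots> = (\<Sum>i<card \<U>. h (f i))" by (simp add: U_def)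
      also have "\<dots> = sum h \<U>" by (rule sum.reindex_bij_betw[OF f])
      finally show ?thesis .
    qed
  qed
qed

lemma hausdorff_premeasure_le_finite_cover:
  fixes E :: "'a::metric_space set"
  assumes "finite \<U>" "E \<subseteq> \<Union>\<U>" "\<And>U. U \<in> \<U> \<Longrightarrow> bounded U \<and> diameter U \<le> d"
    and "d \<le> \<delta>" "0 \<le> \<delta>" "0 < s"
  shows "hausdorff_premeasure s \<delta> E \<le> ennreal (real (card \<U>) * d powr s)"
proof -
  obtain U :: "nat \<Rightarrow> 'a set" where U: "(\<Union>i. U i) = \<Union>\<U>" "\<And>i. U i \<in> insert {} \<U>"
      "\<And>h :: 'a set \<Rightarrow> ennreal. h {} = 0 \<Longrightarrow> (\<Sum>i. h (U i)) = sum h \<U>"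
    using finite_cover_sequence[OF assms(1)] by metis
  \<comment> \<open>The padding sets have diameter 0, which is where \<open>0 \<le> \<delta>\<close>
    enters.\<close>
  have "bounded (U i) \<and> diameter (U i) \<le> \<delta>" for i
    using U(2)[of i] assms(3)[of "U i"] assms(4,5) by auto
  then have "delta_cover \<delta> E U" using assms(2) U(1) by (simp add: delta_cover_def)
  then have "hausdorff_premeasure s \<delta> E \<le> (\<Sum>i. ennreal (diam_power s (U i)))"
    unfolding hausdorff_premeasure_def by (intro INF_lower) simp
  also have "\<dots> = (\<Sum>U\<in>\<U>. ennreal (diam_power s U))"
    by (rule U(3)) (simp add: diam_power_def)
  also have "\<dots> \<le> of_nat (card \<U>) * ennreal (d powr s)"
    using assms(3,6)
    by (intro sum_bounded_above ennreal_leI) (auto simp: diam_power_def diameter_ge_0 intro!: powr_mono2)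
  also have "\<dots> = ennreal (real (card \<U>) * d powr s)"
    by (simp add: ennreal_of_nat_eq_real_of_nat ennreal_mult)
  finally show ?thesis .
qed

lemma covering_number_le:
  assumes "finite \<U>" "E \<subseteq> \<Union>\<U>" "\<And>U. U \<in> \<U> \<Longrightarrow> open U \<and> bounded U \<and> diameter U \<le> r"
  shows "covering_number E r \<le> card \<U>"
  unfolding covering_number_def using assms by (intro Least_le) blast

text \<open>The cover \<open>\<V>\<close> certifies that some finite cardinality is admissible, so
  that the \<open>LEAST\<close> in \<open>covering_number\<close> is a genuine minimum.\<close>

lemma covering_number_attained:
  assumes "finite \<V>" "E \<subseteq> \<Union>\<V>" "\<And>U. U \<in> \<V> \<Longrightarrow> open U \<and> bounded U \<and> diameter U \<le> r"
  obtains \<U> where "finite \<U>" "card \<U> = covering_number E r" "E \<subseteq> \<Union>\<U>"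
    "\<And>U. U \<in> \<U> \<Longrightarrow> open U \<and> bounded U \<and> diameter U \<le> r"
proof -
  have "\<exists>n \<U>. finite \<U> \<and> card \<U> = n \<and> E \<subseteq> \<Union>\<U> \<and>
      (\<forall>U\<in>\<U>. open U \<and> bounded U \<and> diameter U \<le> r)"
    using assms by blast
  from LeastI_ex[OF this] show ?thesis
    unfolding covering_number_def[symmetric] using that by blast
qed

section \<open>Approximate progressions: rescaling and step bounds\<close>

text \<open>Errors and gap length are both divided by \<open>c\<close>. This is used to zoom from
  one half of the Cantor set to the whole set.\<close>

lemma approx_AP_affine:
  assumes "approx_AP k \<epsilon> b" "0 < c" "\<And>i. i < k \<Longrightarrow> b i = d + c * b' i"
  shows "approx_AP k \<epsilon> b'"
proof -
  obtain a \<Delta> where a: "0 < \<Delta>" "\<And>i. i < k \<Longrightarrow> a i = a 0 + real i * \<Delta>"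
      "\<And>i. i < k \<Longrightarrow> \<bar>a i - b i\<bar> \<le> \<epsilon> * \<Delta>"
    using assms(1) unfolding approx_AP_def arith_prog_def by blast
  have "\<bar>(a i - d) / c - b' i\<bar> \<le> \<epsilon> * (\<Delta> / c)" if "i < k" for i
  proof -
    have "(a i - d) / c - b' i = (a i - b i) / c"
      using assms(2) assms(3)[OF that] by (simp add: field_simps)
    then show ?thesis using a(3)[OF that] assms(2) by (simp add: divide_right_mono)
  qed
  moreover have "(a i - d) / c = (a 0 - d) / c + real i * (\<Delta> / c)" if "i < k" for i
    using a(2)[OF that] by (simp add: diff_divide_distrib add_divide_distrib)
  with divide_pos_pos[OF a(1) assms(2)] have "arith_prog k (\<Delta> / c) (\<lambda>i. (a i - d) / c)"
    unfolding arith_prog_def by blast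
  ultimately show ?thesis unfolding approx_AP_def by blast
qed

text \<open>Each difference of two terms involves two errors of at most
  \<open>\<epsilon> * \<Delta>\<close>, whence the \<open>2 * \<epsilon>\<close>. Only these two
  consequences of being an approximate progression are used against the central gap.\<close>

lemma approx_AP_steps:
  assumes "approx_AP k \<epsilon> b" "0 < k" "0 \<le> \<epsilon>"
  obtains \<Delta> where "0 < \<Delta>" "\<And>i. Suc i < k \<Longrightarrow> \<bar>b (Suc i) - b i\<bar> \<le> (1 + 2 * \<epsilon>) * \<Delta>"
    "(real k - 1 - 2 * \<epsilon>) * \<Delta> \<le> b (k - 1) - b 0"
proof -
  obtain a \<Delta> where a: "0 < \<Delta>" "\<And>i. i < k \<Longrightarrow> a i = a 0 + real i * \<Delta>"
      "\<And>i. i < k \<Longrightarrow> \<bar>a i - b i\<bar> \<le> \<epsilon> * \<Delta>"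
    using assms(1) unfolding approx_AP_def arith_prog_def by blast
  show ?thesis
  proof (rule that[of \<Delta>])
    show "\<bar>b (Suc i) - b i\<bar> \<le> (1 + 2 * \<epsilon>) * \<Delta>" if i: "Suc i < k" for i
      using a(1) a(2)[of i] a(2)[of "Suc i"] a(3)[of i] a(3)[of "Suc i"] i
      by (auto simp: algebra_simps abs_le_iff)
    show "(real k - 1 - 2 * \<epsilon>) * \<Delta> \<le> b (k - 1) - b 0"
      using a(2)[of "k - 1"] a(3)[of 0] a(3)[of "k - 1"] assms(2)
      by (auto simp: algebra_simps abs_le_iff of_nat_diff)
  qed (rule a(1))
qed

section \<open>The Cantor set parametrised by binary expansions\<close>

locale cantor_ratio =
  fixes \<rho> :: real
  assumes \<rho>_pos: "0 < \<rho>" and \<rho>_half: "\<rho> < 1 / 2"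
begin

text \<open>The last factor is a binary digit of \<open>t\<close>, so on \<open>[0, 1)\<close> this
  is a right inverse of the Cantor function for ratio \<open>\<rho>\<close>. Digits taken by floors
  are never eventually all one, which is how the right endpoints drop out.\<close>

definition point :: "real \<Rightarrow> real" where
  "point t = (\<Sum>n. (1 - \<rho>) * \<rho> ^ n * of_int (\<lfloor>2 ^ Suc n * t\<rfloor> mod 2))"

definition cantor_set :: "real set" where
  "cantor_set = point ` {0..<1}"

text \<open>The similarity dimension, that is, the root \<open>s\<close> of
  \<open>2 * \<rho> powr s = 1\<close>.\<close>

definition sim_dim :: real where
  "sim_dim = ln 2 / ln (1 / \<rho>)"

text \<open>Chosen to make the right-hand side of \<open>inverse_holder\<close> at least 1 for
  points on different sides of the central gap.\<close>

definition holder_const :: real where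
  "holder_const = (1 - 2 * \<rho>) powr (- sim_dim)"

lemma digit_bounds: "0 \<le> (of_int (m mod 2 :: int) :: real)" "of_int (m mod 2 :: int) \<le> (1::real)"
proof -
  have "m mod 2 = 0 \<or> m mod 2 = 1" by presburger
  then show "0 \<le> (of_int (m mod 2 :: int) :: real)" "of_int (m mod 2 :: int) \<le> (1::real)" by auto
qed

lemma weights_sums: "(\<lambda>n. (1 - \<rho>) * \<rho> ^ n) sums 1"
proof -
  have "(\<lambda>n. (1 - \<rho>) * \<rho> ^ n) sums ((1 - \<rho>) * (1 / (1 - \<rho>)))"
    using \<rho>_pos \<rho>_half by (intro sums_mult geometric_sums) auto
  then show ?thesis using \<rho>_half by simp
qed

lemma summable_point: "summable (\<lambda>n. (1 - \<rho>) * \<rho> ^ n * of_int (\<lfloor>2 ^ Suc n * t\<rfloor> mod 2))"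
proof (rule summable_comparison_test'[OF sums_summable[OF weights_sums], of 0])
  fix n :: nat
  show "norm ((1 - \<rho>) * \<rho> ^ n * of_int (\<lfloor>2 ^ Suc n * t\<rfloor> mod 2)) \<le> (1 - \<rho>) * \<rho> ^ n"
    using \<rho>_pos \<rho>_half digit_bounds[of "\<lfloor>2 ^ Suc n * t\<rfloor>"]
    by (auto simp: abs_mult intro!: mult_left_le)
qed

lemma point_nonneg: "0 \<le> point t"
  unfolding point_def using \<rho>_pos \<rho>_half
  by (intro suminf_nonneg summable_point mult_nonneg_nonneg digit_bounds) auto

lemma point_le_1: "point t \<le> 1"
proof -
  have "point t \<le> (\<Sum>n. (1 - \<rho>) * \<rho> ^ n)"
    unfolding point_def using \<rho>_pos \<rho>_half
    by (intro suminf_le summable_point sums_summable[OF weights_sums] mult_left_le digit_bounds) auto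
  then show ?thesis using weights_sums sums_unique by fastforce
qed

text \<open>Splitting off the first term leaves the series of the shifted digits. Asking only that
  \<open>u\<close> have these digits covers both \<open>2 * t\<close> and
  \<open>2 * t - 1\<close>.\<close>

lemma point_split:
  assumes "\<And>n. \<lfloor>2 ^ Suc (Suc n) * t\<rfloor> mod 2 = \<lfloor>2 ^ Suc n * u\<rfloor> mod 2"
  shows "point t = (1 - \<rho>) * of_int (\<lfloor>2 * t\<rfloor> mod 2) + \<rho> * point u"
proof -
  have "point t = (1 - \<rho>) * of_int (\<lfloor>2 * t\<rfloor> mod 2) +
      (\<Sum>n. (1 - \<rho>) * \<rho> ^ Suc n * of_int (\<lfloor>2 ^ Suc (Suc n) * t\<rfloor> mod 2))"
    unfolding point_def using suminf_split_head[OF summable_point, of t] by simp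
  also have "(\<Sum>n. (1 - \<rho>) * \<rho> ^ Suc n * of_int (\<lfloor>2 ^ Suc (Suc n) * t\<rfloor> mod 2)) =
      (\<Sum>n. \<rho> * ((1 - \<rho>) * \<rho> ^ n * of_int (\<lfloor>2 ^ Suc n * u\<rfloor> mod 2)))"
    unfolding assms by (simp add: mult_ac)
  also have "\<dots> = \<rho> * point u"
    unfolding point_def by (rule suminf_mult[OF summable_point])
  finally show ?thesis .
qed

lemma point_low:
  assumes "0 \<le> t" "t < 1 / 2"
  shows "point t = \<rho> * point (2 * t)"
proof -
  have "\<lfloor>2 * t\<rfloor> = 0" using assms by linarith
  then show ?thesis using point_split[of t "2 * t"] by (simp add: mult_ac)
qed

lemma point_high:
  assumes "1 / 2 \<le> t" "t < 1"
  shows "point t = 1 - \<rho> + \<rho> * point (2 * t - 1)"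
proof -
  have "\<lfloor>2 * t\<rfloor> = 1" using assms by linarith
  \<comment> \<open>Replacing \<open>2 * t\<close> by \<open>2 * t - 1\<close> subtracts an even
    integer from each scaled value, so the later digits keep their parity.\<close>
  moreover have "\<lfloor>2 ^ Suc (Suc n) * t\<rfloor> mod 2 = \<lfloor>2 ^ Suc n * (2 * t - 1)\<rfloor> mod 2" for n
  proof -
    have "2 ^ Suc n * (2 * t - 1) = 2 ^ Suc (Suc n) * t - of_int (2 * 2 ^ n)"
      by (simp add: algebra_simps)
    then have "\<lfloor>2 ^ Suc n * (2 * t - 1)\<rfloor> = \<lfloor>2 ^ Suc (Suc n) * t\<rfloor> - 2 * 2 ^ n"
      by (simp only: floor_diff_of_int)
    then show ?thesis by presburger
  qed
  ultimately show ?thesis using point_split[of t "2 * t - 1"] by simp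
qed

text \<open>Each step in the upper half doubles \<open>1 - t\<close>, so the parameter enters the
  lower half eventually, and there the value is at most \<open>\<rho>\<close>. The exponent
  \<open>n\<close> bounds the number of steps.\<close>

lemma point_less_1:
  assumes "0 \<le> t" "t < 1"
  shows "point t < 1"
proof -
  obtain n where "(1 / 2) ^ n < 1 - t"
    using real_arch_pow_inv[of "1 - t" "1 / 2"] assms by auto
  then show ?thesis using assms
  proof (induction n arbitrary: t)
    case 0
    then show ?case by simp
  next
    case (Suc n)
    show ?case
    proof (cases "t < 1 / 2")
      case True
      then have "point t \<le> \<rho>"
        using point_low[of t] point_le_1[of "2 * t"] Suc.prems \<rho>_pos by (simp add: mult_left_le)
      then show ?thesis using \<rho>_half by simp
    next
      case False
      have "point (2 * t - 1) < 1"
        using Suc.prems False by (intro Suc.IH) auto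
      then have "\<rho> * point (2 * t - 1) < \<rho>" using \<rho>_pos by simp
      then show ?thesis using point_high[of t] False Suc.prems by simp
    qed
  qed
qed

lemma point_low_less:
  assumes "0 \<le> t" "t < 1 / 2"
  shows "point t < \<rho>"
  using point_low[OF assms] point_less_1[of "2 * t"] assms \<rho>_pos by simp

lemma point_high_ge:
  assumes "1 / 2 \<le> t" "t < 1"
  shows "1 - \<rho> \<le> point t"
  using point_high[OF assms] point_nonneg[of "2 * t - 1"] \<rho>_pos by simp

text \<open>Both points lie in the image of the same similarity, which is undone for both at once.
  This is the induction step of \<open>point_cylinder\<close> and
  \<open>inverse_holder\<close>.\<close>

lemma point_same_half:
  assumes "t \<in> {0..<1}" "u \<in> {0..<1}" "t < 1 / 2 \<longleftrightarrow> u < 1 / 2"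
  obtains t' u' where "t' \<in> {0..<1}" "u' \<in> {0..<1}" "t' - u' = 2 * (t - u)"
    "point t - point u = \<rho> * (point t' - point u')"
    "\<And>n. \<lfloor>2 ^ Suc n * t\<rfloor> = \<lfloor>2 ^ Suc n * u\<rfloor> \<Longrightarrow> \<lfloor>2 ^ n * t'\<rfloor> = \<lfloor>2 ^ n * u'\<rfloor>"
proof (cases "t < 1 / 2")
  case True
  show ?thesis
    using assms True point_low[of t] point_low[of u]
    by (intro that[of "2 * t" "2 * u"]) (auto simp: algebra_simps)
next
  case False
  have "\<lfloor>2 ^ n * (2 * x - 1)\<rfloor> = \<lfloor>2 ^ Suc n * x\<rfloor> - 2 ^ n" for n and x :: real
  proof -
    have "2 ^ n * (2 * x - 1) = 2 ^ Suc n * x - of_int (2 ^ n)"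
      by (simp add: algebra_simps)
    then show ?thesis by (simp only: floor_diff_of_int)
  qed
  then show ?thesis
    using assms False point_high[of t] point_high[of u]
    by (intro that[of "2 * t - 1" "2 * u - 1"]) (simp_all add: right_diff_distrib)
qed

lemma gap_less:
  assumes "t \<in> {0..<1}" "u \<in> {0..<1}" "\<not> (t < 1 / 2 \<longleftrightarrow> u < 1 / 2)"
  shows "1 - 2 * \<rho> < \<bar>point t - point u\<bar>"
  using assms point_low_less[of t] point_low_less[of u] point_high_ge[of t] point_high_ge[of u] \<rho>_half
  by (cases "t < 1 / 2") auto

lemma point_cylinder:
  assumes "t \<in> {0..<1}" "u \<in> {0..<1}" "\<lfloor>2 ^ n * t\<rfloor> = \<lfloor>2 ^ n * u\<rfloor>"
  shows "\<bar>point t - point u\<bar> \<le> \<rho> ^ n"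
  using assms
proof (induction n arbitrary: t u)
  case 0
  then show ?case
    using point_nonneg[of t] point_nonneg[of u] point_le_1[of t] point_le_1[of u] by auto
next
  case (Suc n)
  \<comment> \<open>The dyadic interval of level \<open>Suc n\<close> determines the half, so equal
    floors put \<open>t\<close> and \<open>u\<close> in the same one.\<close>
  have half: "x < 1 / 2 \<longleftrightarrow> \<lfloor>2 ^ Suc n * x\<rfloor> < 2 ^ n" for x :: real
    by (simp add: floor_less_iff) (simp add: mult.commute mult.left_commute)
  obtain t' u' where "t' \<in> {0..<1}" "u' \<in> {0..<1}" "point t - point u = \<rho> * (point t' - point u')"
      "\<lfloor>2 ^ n * t'\<rfloor> = \<lfloor>2 ^ n * u'\<rfloor>"
    using point_same_half[OF Suc.prems(1,2)] half[of t] half[of u] Suc.prems(3) by metis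
  then show ?case using Suc.IH[of t' u'] \<rho>_pos by (simp add: abs_mult)
qed

section \<open>Hoelder continuity of the inverse and lower bounds on mass\<close>

lemma sim_dim_pos: "0 < sim_dim"
  using \<rho>_pos \<rho>_half by (simp add: sim_dim_def)

lemma \<rho>_powr_sim_dim: "\<rho> powr sim_dim = 1 / 2"
proof -
  have "sim_dim * ln \<rho> = - ln 2"
    using \<rho>_pos \<rho>_half by (simp add: sim_dim_def ln_div)
  then show ?thesis
    using \<rho>_pos by (simp add: powr_def exp_minus field_simps)
qed

lemma holder_const_pos: "0 < holder_const"
  using \<rho>_half by (simp add: holder_const_def)

text \<open>While the parameters share a half, zooming doubles both sides, because
  \<open>\<rho> powr sim_dim = 1 / 2\<close>. Since \<open>\<bar>t - u\<bar>\<close> stays below 1,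
  they separate after finitely many steps, and then the central gap gives the bound.\<close>

lemma inverse_holder:
  assumes "t \<in> {0..<1}" "u \<in> {0..<1}"
  shows "\<bar>t - u\<bar> \<le> holder_const * \<bar>point t - point u\<bar> powr sim_dim"
proof (cases "t = u")
  case False
  then obtain n where "(1 / 2) ^ n < \<bar>t - u\<bar>"
    using real_arch_pow_inv[of "\<bar>t - u\<bar>" "1 / 2"] by auto
  then show ?thesis using assms
  proof (induction n arbitrary: t u)
    case 0
    then show ?case by auto
  next
    case (Suc n)
    show ?case
    proof (cases "t < 1 / 2 \<longleftrightarrow> u < 1 / 2")
      case True
      obtain t' u' where *: "t' \<in> {0..<1}" "u' \<in> {0..<1}" "t' - u' = 2 * (t - u)"
          "point t - point u = \<rho> * (point t' - point u')"
        using point_same_half[OF Suc.prems(2,3) True] by metis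
      have tu: "\<bar>t' - u'\<bar> = 2 * \<bar>t - u\<bar>" by (simp only: *(3) abs_mult abs_numeral)
      then have "\<bar>t' - u'\<bar> \<le> holder_const * \<bar>point t' - point u'\<bar> powr sim_dim"
        using *(1,2) Suc.prems(1) by (intro Suc.IH) auto
      then have "\<bar>t - u\<bar> \<le> holder_const * (\<bar>point t' - point u'\<bar> powr sim_dim * (1 / 2))"
        using tu by simp
      also have "\<bar>point t' - point u'\<bar> powr sim_dim * (1 / 2) = \<bar>point t - point u\<bar> powr sim_dim"
        using *(4) \<rho>_pos by (simp add: abs_mult powr_mult \<rho>_powr_sim_dim)
      finally show ?thesis .
    next
      case False
      have "(1 - 2 * \<rho>) powr sim_dim \<le> \<bar>point t - point u\<bar> powr sim_dim"
        using gap_less[OF Suc.prems(2,3) False] \<rho>_half sim_dim_pos by (intro powr_mono2) auto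
      then have "holder_const * (1 - 2 * \<rho>) powr sim_dim \<le> holder_const * \<bar>point t - point u\<bar> powr sim_dim"
        using holder_const_pos by simp
      moreover have "holder_const * (1 - 2 * \<rho>) powr sim_dim = 1"
        using \<rho>_half by (simp add: holder_const_def powr_minus)
      ultimately show ?thesis using Suc.prems by auto
    qed
  qed
qed (use holder_const_pos in auto)

text \<open>By \<open>inverse_holder\<close>, the preimages under \<^term>\<open>point\<close> of the \<open>U i\<close> lie in intervals of the lengths summed here,
  and the intervals cover \<open>[0, 1)\<close>.\<close>

lemma cover_mass:
  assumes cov: "cantor_set \<subseteq> (\<Union>i. U i)" and bdd: "\<And>i. bounded (U i)"
  shows "1 \<le> (\<Sum>i. ennreal (holder_const * diameter (U i) powr sim_dim))"
proof -
  define T where "T i = {t \<in> {0..<1}. point t \<in> U i}" for i :: nat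
  define d where "d i = holder_const * diameter (U i) powr sim_dim" for i :: nat
  have d0: "0 \<le> d i" for i using holder_const_pos by (simp add: d_def)
  \<comment> \<open>Any two elements of \<open>T i\<close> are at distance at most
    \<open>d i\<close>. If \<open>T i\<close> is empty the inclusion holds whatever the value of
    \<open>Inf {}\<close>.\<close>
  have T: "T i \<subseteq> {Inf (T i)..Inf (T i) + d i}" for i
  proof
    fix t assume t: "t \<in> T i"
    have bb: "bdd_below (T i)" by (rule bdd_belowI[of _ 0]) (auto simp: T_def)
    have "t - d i \<le> u" if u: "u \<in> T i" for u
    proof -
      have "\<bar>t - u\<bar> \<le> holder_const * \<bar>point t - point u\<bar> powr sim_dim"
        using t u by (intro inverse_holder) (auto simp: T_def)
      also have "\<dots> \<le> d i"
        unfolding d_def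
        using t u holder_const_pos sim_dim_pos diameter_bounded_bound[OF bdd, of "point t" i "point u"]
        by (intro mult_left_mono powr_mono2) (auto simp: T_def dist_real_def)
      finally show ?thesis by linarith
    qed
    then have "t - d i \<le> Inf (T i)" using t by (intro cInf_greatest) auto
    then show "t \<in> {Inf (T i)..Inf (T i) + d i}" using cInf_lower[OF t bb] by auto
  qed
  have "{0..<1} \<subseteq> (\<Union>i. T i)" using cov by (force simp: cantor_set_def T_def)
  \<comment> \<open>The sets \<open>U i\<close> are arbitrary; passing to intervals avoids the
    measurability of the preimages \<open>T i\<close>.\<close>
  then have "{0..<1} \<subseteq> (\<Union>i. {Inf (T i)..Inf (T i) + d i})" using T by blast
  then have "emeasure lborel {0..<1::real} \<le> emeasure lborel (\<Union>i. {Inf (T i)..Inf (T i) + d i})"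
    by (intro emeasure_mono) auto
  also have "\<dots> \<le> (\<Sum>i. emeasure lborel {Inf (T i)..Inf (T i) + d i})"
    by (intro emeasure_subadditive_countably) auto
  also have "\<dots> = (\<Sum>i. ennreal (d i))" using d0 by simp
  finally show ?thesis by (simp add: d_def)
qed

lemma finite_cover_mass:
  assumes "finite \<U>" "cantor_set \<subseteq> \<Union>\<U>" "\<And>U. U \<in> \<U> \<Longrightarrow> bounded U \<and> diameter U \<le> r"
  shows "1 \<le> real (card \<U>) * (holder_const * r powr sim_dim)"
proof -
  obtain U :: "nat \<Rightarrow> real set" where U: "(\<Union>i. U i) = \<Union>\<U>" "\<And>i. U i \<in> insert {} \<U>"
      "\<And>h :: real set \<Rightarrow> ennreal. h {} = 0 \<Longrightarrow> (\<Sum>i. h (U i)) = sum h \<U>"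
    using finite_cover_sequence[OF assms(1)] by metis
  have "1 \<le> (\<Sum>i. ennreal (holder_const * diameter (U i) powr sim_dim))"
    using assms(2,3) U(1) U(2) by (intro cover_mass) (simp, metis bounded_empty insertE)
  also have "\<dots> = (\<Sum>U\<in>\<U>. ennreal (holder_const * diameter U powr sim_dim))"
    by (rule U(3)) simp
  also have "\<dots> \<le> of_nat (card \<U>) * ennreal (holder_const * r powr sim_dim)"
    using assms(3) holder_const_pos sim_dim_pos
    by (intro sum_bounded_above ennreal_leI mult_left_mono powr_mono2) (auto simp: diameter_ge_0)
  also have "\<dots> = ennreal (real (card \<U>) * (holder_const * r powr sim_dim))"
    using holder_const_pos by (simp add: ennreal_of_nat_eq_real_of_nat ennreal_mult)
  finally show ?thesis by (simp add: ennreal_le_iff2 flip: ennreal_1)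
qed

section \<open>Upper bounds from covers by dyadic cylinders\<close>

text \<open>By \<open>point_cylinder\<close>, one ball about a chosen point of each cylinder
  suffices. The radius is doubled because the balls are open while that estimate is not
  strict.\<close>

lemma cylinder_cover:
  assumes "finite J"
  obtains \<U> where "finite \<U>" "card \<U> \<le> card J" "point ` {t \<in> {0..<1}. \<lfloor>2 ^ n * t\<rfloor> \<in> J} \<subseteq> \<Union>\<U>"
    "\<And>U. U \<in> \<U> \<Longrightarrow> open U \<and> bounded U \<and> diameter U \<le> 4 * \<rho> ^ n"
proof -
  \<comment> \<open>For an index \<open>j\<close> of no parameter in \<open>[0, 1)\<close> the
    choice is arbitrary and only adds a harmless ball.\<close>
  define c :: "int \<Rightarrow> real" where "c j = (SOME t. t \<in> {0..<1} \<and> \<lfloor>2 ^ n * t\<rfloor> = j)" for j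
  define \<U> where "\<U> = (\<lambda>j. ball (point (c j)) (2 * \<rho> ^ n)) ` J"
  show ?thesis
  proof (rule that[of \<U>])
    show "point ` {t \<in> {0..<1}. \<lfloor>2 ^ n * t\<rfloor> \<in> J} \<subseteq> \<Union>\<U>"
    proof clarify
      fix t :: real assume t: "t \<in> {0..<1}" "\<lfloor>2 ^ n * t\<rfloor> \<in> J"
      define j where "j = \<lfloor>2 ^ n * t\<rfloor>"
      have "c j \<in> {0..<1} \<and> \<lfloor>2 ^ n * c j\<rfloor> = j"
        unfolding c_def using t(1) by (rule_tac someI[of _ t]) (simp add: j_def)
      then have "\<bar>point (c j) - point t\<bar> \<le> \<rho> ^ n"
        using t(1) by (intro point_cylinder) (auto simp: j_def)
      also have "\<dots> < 2 * \<rho> ^ n" using \<rho>_pos by simp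
      finally show "point t \<in> \<Union>\<U>" using t(2) by (auto simp: \<U>_def j_def dist_real_def)
    qed
  qed (use assms \<rho>_pos in \<open>auto simp: \<U>_def intro: card_image_le\<close>)
qed

lemma level_cover:
  obtains \<U> where "finite \<U>" "card \<U> \<le> 2 ^ n" "cantor_set \<subseteq> \<Union>\<U>"
    "\<And>U. U \<in> \<U> \<Longrightarrow> open U \<and> bounded U \<and> diameter U \<le> 4 * \<rho> ^ n"
proof -
  have "\<lfloor>2 ^ n * t\<rfloor> \<in> {0..<2 ^ n}" if "t \<in> {0..<1}" for t :: real
    using that by (auto simp: floor_less_iff)
  then have eq: "cantor_set = point ` {t \<in> {0..<1}. \<lfloor>2 ^ n * t\<rfloor> \<in> {0..<2 ^ n}}"
    by (auto simp: cantor_set_def)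
  have "card {0..<2 ^ n :: int} = 2 ^ n" by (simp add: nat_power_eq)
  then show ?thesis
    using that cylinder_cover[of "{0..<2 ^ n}" n, folded eq] by (metis finite_atLeastLessThan_int)
qed

section \<open>Hausdorff dimension\<close>

lemma four_power_tendsto_0: "(\<lambda>n. 4 * \<rho> ^ n) \<longlonglongrightarrow> 0"
  using \<rho>_pos \<rho>_half by (intro tendsto_mult_right_zero LIMSEQ_realpow_zero) auto

text \<open>The level \<open>n\<close> cover has \<open>s\<close>-mass at most
  \<open>4 powr s * (2 * \<rho> powr s) ^ n\<close>, and the base of this power is below 1 exactly
  because \<open>s\<close> exceeds \<open>sim_dim\<close>.\<close>

lemma hausdorff_measure_eq_0:
  assumes "sim_dim < s"
  shows "hausdorff_measure s cantor_set = 0"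
proof -
  have s: "0 < s" using sim_dim_pos assms by simp
  have "hausdorff_premeasure s \<delta> cantor_set = 0" if \<delta>: "0 < \<delta>" for \<delta>
  proof -
    define q where "q = 2 * \<rho> powr s"
    have "\<rho> powr s < \<rho> powr sim_dim"
      using \<rho>_pos \<rho>_half assms by (intro powr_less_mono') auto
    then have q: "0 \<le> q" "q < 1" by (auto simp: q_def \<rho>_powr_sim_dim)
    have bound: "hausdorff_premeasure s \<delta> cantor_set \<le> ennreal (4 powr s * q ^ n)"
      if n: "4 * \<rho> ^ n < \<delta>" for n
    proof -
      obtain \<U> where \<U>: "finite \<U>" "card \<U> \<le> 2 ^ n" "cantor_set \<subseteq> \<Union>\<U>"
          "\<And>U. U \<in> \<U> \<Longrightarrow> open U \<and> bounded U \<and> diameter U \<le> 4 * \<rho> ^ n"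
        by (rule level_cover[of n]) blast
      have "hausdorff_premeasure s \<delta> cantor_set \<le> ennreal (real (card \<U>) * (4 * \<rho> ^ n) powr s)"
        using \<U> n s \<delta> by (intro hausdorff_premeasure_le_finite_cover) auto
      also have "\<dots> \<le> ennreal (2 ^ n * (4 * \<rho> ^ n) powr s)"
        using \<U>(2) by (intro ennreal_leI mult_right_mono)
          (auto simp: of_nat_le_iff[symmetric] simp del: of_nat_le_iff)
      also have "2 ^ n * (4 * \<rho> ^ n) powr s = 4 powr s * q ^ n"
        using \<rho>_pos by (simp add: q_def powr_mult power_mult_distrib powr_power powr_powr
            mult.commute flip: powr_realpow)
      finally show ?thesis .
    qed
    have "(\<lambda>n. 4 powr s * q ^ n) \<longlonglongrightarrow> 0"
      using q by (intro tendsto_mult_right_zero LIMSEQ_realpow_zero) auto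
    then have "(\<lambda>n. ennreal (4 powr s * q ^ n)) \<longlonglongrightarrow> 0"
      using tendsto_ennrealI by fastforce
    \<comment> \<open>The bound is available only at levels fine enough for \<open>\<delta>\<close>,
      which is enough for the limit.\<close>
    moreover have "\<forall>\<^sub>F n in sequentially. 4 * \<rho> ^ n < \<delta>"
      using four_power_tendsto_0 \<delta> by (rule order_tendstoD)
    ultimately have "hausdorff_premeasure s \<delta> cantor_set \<le> 0"
      by (intro tendsto_lowerbound[of _ _ sequentially]) (auto elim: eventually_mono intro: bound)
    then show ?thesis by simp
  qed
  then show ?thesis by (simp add: hausdorff_measure_def)
qed

text \<open>For sets of diameter at most 1, lowering the exponent raises the summands, so
  \<open>cover_mass\<close> bounds the premeasure at scale 1 from below.\<close>

lemma hausdorff_measure_pos: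
  assumes "0 \<le> s" "s < sim_dim"
  shows "hausdorff_measure s cantor_set \<noteq> 0"
proof -
  have "ennreal (1 / holder_const) \<le> hausdorff_premeasure s 1 cantor_set"
    unfolding hausdorff_premeasure_def
  proof (rule INF_greatest)
    fix U :: "nat \<Rightarrow> real set" assume "U \<in> {U. delta_cover 1 cantor_set U}"
    then have U: "cantor_set \<subseteq> (\<Union>i. U i)" "\<And>i. bounded (U i)" "\<And>i. diameter (U i) \<le> 1"
      by (auto simp: delta_cover_def)
    \<comment> \<open>For \<open>s = 0\<close> the right side is 1 on nonempty sets; on
      \<open>{}\<close> both sides vanish.\<close>
    have le: "diameter (U i) powr sim_dim \<le> diam_power s (U i)" for i
    proof -
      have "0 \<le> diameter (U i)" using U(2) by (rule diameter_ge_0)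
      then show ?thesis
        using U(3)[of i] assms sim_dim_pos powr_mono'[of s sim_dim "diameter (U i)"]
        by (auto simp: diam_power_def powr_le1)
    qed
    have "1 \<le> (\<Sum>i. ennreal (holder_const * diameter (U i) powr sim_dim))"
      using U by (intro cover_mass)
    also have "\<dots> = ennreal holder_const * (\<Sum>i. ennreal (diameter (U i) powr sim_dim))"
      using holder_const_pos by (simp add: ennreal_mult ennreal_suminf_cmult)
    also have "\<dots> \<le> ennreal holder_const * (\<Sum>i. ennreal (diam_power s (U i)))"
      by (intro mult_left_mono suminf_le ennreal_leI le) auto
    finally have "ennreal (1 / holder_const) * 1
      \<le> ennreal (1 / holder_const) * (ennreal holder_const * (\<Sum>i. ennreal (diam_power s (U i))))"
      by (rule mult_left_mono) simp
    then show "ennreal (1 / holder_const) \<le> (\<Sum>i. ennreal (diam_power s (U i)))"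
      using holder_const_pos by (simp add: mult.assoc[symmetric] flip: ennreal_mult)
  qed
  also have "\<dots> \<le> hausdorff_measure s cantor_set"
    unfolding hausdorff_measure_def by (rule SUP_upper) simp
  finally show ?thesis using holder_const_pos by auto
qed

lemma hausdorff_dim_cantor_set: "hausdorff_dim cantor_set = ereal sim_dim"
proof (rule antisym)
  show "hausdorff_dim cantor_set \<le> ereal sim_dim"
  \<comment> \<open>Measure zero is known only strictly above \<open>sim_dim\<close>, so the bound
    is obtained by approximation from above.\<close>
  proof (rule dense_ge)
    fix y :: ereal assume y: "ereal sim_dim < y"
    show "hausdorff_dim cantor_set \<le> y"
    proof (cases y)
      case (real s)
      then show ?thesis
        unfolding hausdorff_dim_def using y hausdorff_measure_eq_0[of s] sim_dim_pos
        by (intro Inf_lower) auto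
    qed (use y in auto)
  qed
  show "ereal sim_dim \<le> hausdorff_dim cantor_set"
    unfolding hausdorff_dim_def using hausdorff_measure_pos
    by (intro Inf_greatest) (auto intro: leI)
qed

section \<open>Assouad dimension\<close>

text \<open>By \<open>inverse_holder\<close>, the ball has its parameters in an interval of length
  \<open>2 * L\<close>, with \<open>L\<close> proportional to \<open>R powr sim_dim\<close>. At the
  first level \<open>n\<close> with \<open>4 * \<rho> ^ n \<le> r\<close> this interval meets at
  most \<open>2 * 2 ^ n * L + 2\<close> dyadic intervals, and minimality of \<open>n\<close> bounds
  \<open>2 ^ n\<close>. The summand 2 is absorbed since \<open>R / r\<close> exceeds 1.\<close>

lemma covering_number_ball:
  assumes r: "0 < r" "r < R" and x: "x \<in> cantor_set"
  shows "real (covering_number (cball x R \<inter> cantor_set) r)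
    \<le> (2 * holder_const * (\<rho> / 4) powr - sim_dim + 2) * (R / r) powr sim_dim"
proof -
  obtain t0 where t0: "t0 \<in> {0..<1}" "x = point t0" using x by (auto simp: cantor_set_def)
  have "\<exists>n. 4 * \<rho> ^ n \<le> r"
    using order_tendstoD(2)[OF four_power_tendsto_0 r(1)]
    by (auto simp: eventually_sequentially intro: less_imp_le)
  then obtain n where n: "4 * \<rho> ^ n \<le> r" and least: "\<And>m. m < n \<Longrightarrow> r < 4 * \<rho> ^ m"
    using exists_least_iff[of "\<lambda>n. 4 * \<rho> ^ n \<le> r"] by (auto simp: not_le)
  have ratio: "1 \<le> (R / r) powr sim_dim" using r sim_dim_pos by (intro ge_one_powr_ge_zero) auto
  show ?thesis
  proof (cases "n = 0")
    \<comment> \<open>There is no previous level to compare with, but a single ball covers the whole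
      set.\<close>
    case True
    obtain \<U> where \<U>: "finite \<U>" "card \<U> \<le> 2 ^ 0" "cantor_set \<subseteq> \<Union>\<U>"
        "\<And>U. U \<in> \<U> \<Longrightarrow> open U \<and> bounded U \<and> diameter U \<le> 4 * \<rho> ^ 0"
      by (rule level_cover[of 0]) blast
    have "open U \<and> bounded U \<and> diameter U \<le> r" if "U \<in> \<U>" for U
      using \<U>(4)[OF that] n True by auto
    then have "covering_number (cball x R \<inter> cantor_set) r \<le> card \<U>"
      using \<U>(1,3) by (intro covering_number_le) auto
    then have "real (covering_number (cball x R \<inter> cantor_set) r) \<le> 1" using \<U>(2) by simp
    also have "1 \<le> (2 * holder_const * (\<rho> / 4) powr - sim_dim + 2) * (R / r) powr sim_dim"
      using mult_mono[of 1 "2 * holder_const * (\<rho> / 4) powr - sim_dim + 2" 1 "(R / r) powr sim_dim"]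
        ratio holder_const_pos by simp
    finally show ?thesis .
  next
    case False
    define L where "L = holder_const * R powr sim_dim"
    define J where "J = {\<lfloor>2 ^ n * (t0 - L)\<rfloor>..\<lfloor>2 ^ n * (t0 + L)\<rfloor>}"
    have "finite J" by (simp add: J_def)
    have L: "0 < L" using holder_const_pos r by (simp add: L_def)
    have sub: "cball x R \<inter> cantor_set \<subseteq> point ` {t \<in> {0..<1}. \<lfloor>2 ^ n * t\<rfloor> \<in> J}"
    proof
      fix y assume "y \<in> cball x R \<inter> cantor_set"
      then obtain t where t: "t \<in> {0..<1}" "y = point t" "\<bar>point t - point t0\<bar> \<le> R"
        by (auto simp: cantor_set_def t0(2) dist_real_def abs_minus_commute)
      have "\<bar>t - t0\<bar> \<le> holder_const * \<bar>point t - point t0\<bar> powr sim_dim" using t t0 by (intro inverse_holder)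
      also have "\<dots> \<le> L"
        unfolding L_def using t(3) holder_const_pos sim_dim_pos by (intro mult_left_mono powr_mono2) auto
      finally have "t0 - L \<le> t" "t \<le> t0 + L" by auto
      then have "\<lfloor>2 ^ n * t\<rfloor> \<in> J" by (auto simp: J_def intro!: floor_mono)
      then show "y \<in> point ` {t \<in> {0..<1}. \<lfloor>2 ^ n * t\<rfloor> \<in> J}" using t by blast
    qed
    obtain \<U> where \<U>: "finite \<U>" "card \<U> \<le> card J" "point ` {t \<in> {0..<1}. \<lfloor>2 ^ n * t\<rfloor> \<in> J} \<subseteq> \<Union>\<U>"
        "\<And>U. U \<in> \<U> \<Longrightarrow> open U \<and> bounded U \<and> diameter U \<le> 4 * \<rho> ^ n"
      by (rule cylinder_cover[OF \<open>finite J\<close>, of n]) blast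
    have "open U \<and> bounded U \<and> diameter U \<le> r" if "U \<in> \<U>" for U
      using \<U>(4)[OF that] n by auto
    then have "covering_number (cball x R \<inter> cantor_set) r \<le> card \<U>"
      using \<U>(1) order.trans[OF sub \<U>(3)] by (intro covering_number_le)
    then have "real (covering_number (cball x R \<inter> cantor_set) r) \<le> real (card J)" using \<U>(2) by simp
    also have "real (card J) \<le> 2 * (2 ^ n * L) + 2"
    proof -
      have "2 ^ n * (t0 - L) \<le> 2 ^ n * (t0 + L)" using L by simp
      then have "\<lfloor>2 ^ n * (t0 - L)\<rfloor> \<le> \<lfloor>2 ^ n * (t0 + L)\<rfloor>" by (rule floor_mono)
      then have "real (card J) = of_int \<lfloor>2 ^ n * (t0 + L)\<rfloor> - of_int \<lfloor>2 ^ n * (t0 - L)\<rfloor> + 1"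
        by (simp add: J_def)
      moreover have "2 ^ n * (t0 + L) - 2 ^ n * (t0 - L) = 2 * (2 ^ n * L)"
        by (simp add: algebra_simps)
      ultimately show ?thesis by linarith
    qed
    also have "2 ^ n * L \<le> holder_const * (\<rho> / 4) powr - sim_dim * (R / r) powr sim_dim"
    proof -
      \<comment> \<open>Level \<open>n - 1\<close> is still too coarse:
        \<open>r < 4 * \<rho> ^ (n - 1)\<close>.\<close>
      have "r * \<rho> / 4 < \<rho> ^ n"
        using least[of "n - 1"] False \<rho>_pos by (cases n) (auto simp: field_simps)
      then have "(r * (\<rho> / 4)) powr sim_dim \<le> (\<rho> ^ n) powr sim_dim"
        using r \<rho>_pos sim_dim_pos by (intro powr_mono2) auto
      also have "(\<rho> ^ n) powr sim_dim = (\<rho> powr sim_dim) ^ n"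
        using \<rho>_pos by (simp add: powr_power mult.commute powr_powr flip: powr_realpow)
      also have "\<dots> = 1 / 2 ^ n" by (simp add: \<rho>_powr_sim_dim power_divide)
      finally have "r powr sim_dim * (\<rho> / 4) powr sim_dim \<le> 1 / 2 ^ n"
        using r \<rho>_pos by (simp only: powr_mult)
      then have "2 ^ n \<le> (\<rho> / 4) powr - sim_dim / r powr sim_dim"
        using r \<rho>_pos by (simp add: powr_minus field_simps)
      then have "2 ^ n * L \<le> (\<rho> / 4) powr - sim_dim / r powr sim_dim * L"
        using L by (intro mult_right_mono) auto
      then show ?thesis using r by (simp add: L_def powr_divide mult_ac)
    qed
    finally show ?thesis using ratio by (simp add: algebra_simps)
  qed
qed

text \<open>For the lower bound an admissible \<open>s\<close> is tested on the ball of radius 1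
  about 0, which contains the whole set. A minimal cover and \<open>finite_cover_mass\<close> then
  give \<open>1 \<le> C * holder_const * r powr (sim_dim - s)\<close>, which fails for small
  \<open>r\<close> if \<open>s < sim_dim\<close>.\<close>

lemma assouad_dim_cantor_set: "assouad_dim cantor_set = ereal sim_dim"
proof (rule antisym)
  have "0 < 2 * holder_const * (\<rho> / 4) powr - sim_dim + 2"
    using holder_const_pos by (simp add: add_nonneg_pos)
  then have "\<exists>C>0. \<forall>R>0. \<forall>r. 0 < r \<and> r < R \<longrightarrow>
      (\<forall>x\<in>cantor_set. real (covering_number (cball x R \<inter> cantor_set) r) \<le> C * (R / r) powr sim_dim)"
    using covering_number_ball by blast
  then show "assouad_dim cantor_set \<le> ereal sim_dim"
    unfolding assouad_dim_def using sim_dim_pos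
    by (intro Inf_lower) simp
  show "ereal sim_dim \<le> assouad_dim cantor_set"
    unfolding assouad_dim_def
  proof (intro Inf_greatest, clarify)
    fix s C :: real
    assume s: "0 \<le> s" and C: "0 < C" and
      bound: "\<forall>R>0. \<forall>r. 0 < r \<and> r < R \<longrightarrow>
        (\<forall>x\<in>cantor_set. real (covering_number (cball x R \<inter> cantor_set) r) \<le> C * (R / r) powr s)"
    have one: "1 \<le> C * holder_const * r powr (sim_dim - s)" if r: "0 < r" "r < 1" for r
    proof -
      have "0 \<in> cantor_set"
        by (auto simp: cantor_set_def point_def intro!: image_eqI[of _ _ 0])
      moreover have "cball 0 1 \<inter> cantor_set = cantor_set"
        using point_nonneg point_le_1 by (auto simp: cantor_set_def)
      ultimately have N: "real (covering_number cantor_set r) \<le> C * (1 / r) powr s"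
        using bound r by (metis zero_less_one)
      obtain n where n: "4 * \<rho> ^ n < r"
        using order_tendstoD(2)[OF four_power_tendsto_0 r(1)] by (auto simp: eventually_sequentially)
      obtain \<V> where \<V>: "finite \<V>" "cantor_set \<subseteq> \<Union>\<V>"
          "\<And>U. U \<in> \<V> \<Longrightarrow> open U \<and> bounded U \<and> diameter U \<le> 4 * \<rho> ^ n"
        by (rule level_cover[of n]) blast
      have "open U \<and> bounded U \<and> diameter U \<le> r" if "U \<in> \<V>" for U
        using \<V>(3)[OF that] n by auto
      with \<V>(1,2) obtain \<U> where \<U>: "finite \<U>" "card \<U> = covering_number cantor_set r" "cantor_set \<subseteq> \<Union>\<U>"
          "\<And>U. U \<in> \<U> \<Longrightarrow> open U \<and> bounded U \<and> diameter U \<le> r"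
        by (rule covering_number_attained) blast+
      have "1 \<le> real (card \<U>) * (holder_const * r powr sim_dim)"
        using \<U> by (intro finite_cover_mass) auto
      also have "\<dots> \<le> C * (1 / r) powr s * (holder_const * r powr sim_dim)"
        using N \<U>(2) holder_const_pos by (intro mult_right_mono) auto
      also have "\<dots> = C * holder_const * r powr (sim_dim - s)"
        using r by (simp add: powr_diff powr_divide)
      finally show ?thesis .
    qed
    show "ereal sim_dim \<le> ereal s"
    proof (rule ccontr)
      assume "\<not> ereal sim_dim \<le> ereal s"
      then have "((\<lambda>r. r powr (sim_dim - s)) \<longlongrightarrow> 0) (at_right 0)"
        using tendsto_zero_powrI[of "\<lambda>r. r" "at_right 0" "\<lambda>_. sim_dim - s" "sim_dim - s"]
        by (auto simp: eventually_at_right_less less_imp_le eventually_mono[OF eventually_at_right_less])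
      then have "((\<lambda>r. C * holder_const * r powr (sim_dim - s)) \<longlongrightarrow> 0) (at_right 0)"
        by (rule tendsto_mult_right_zero)
      moreover have "\<forall>\<^sub>F r in at_right 0. 1 \<le> C * holder_const * r powr (sim_dim - s)"
        unfolding eventually_at_right_field using one by (intro exI[of _ 1]) auto
      ultimately have "1 \<le> (0::real)"
        by (intro tendsto_lowerbound[of _ _ "at_right (0::real)"]) auto
      then show False by simp
    qed
  qed
qed

section \<open>Absence of approximate progressions\<close>

text \<open>Each zoom into a common half doubles the parameter distance between the first and last
  terms. As this distance stays below 1, the induction on \<open>n\<close> must reach a progression
  meeting both halves, where \<open>gap\<close> gives the contradiction.\<close>

lemma no_approx_AP:
  assumes k: "2 * \<epsilon> < real k - 1" and \<epsilon>: "0 \<le> \<epsilon>"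
    and gap: "1 + 2 * \<epsilon> \<le> (1 - 2 * \<rho>) * (real k - 1 - 2 * \<epsilon>)"
  shows "\<not> contains_approx_AP cantor_set k \<epsilon>"
proof
  assume "contains_approx_AP cantor_set k \<epsilon>"
  then obtain b where b: "approx_AP k \<epsilon> b" "\<forall>i<k. b i \<in> cantor_set"
    by (auto simp: contains_approx_AP_def)
  then have "\<forall>i. \<exists>t. i < k \<longrightarrow> t \<in> {0..<1} \<and> b i = point t"
    unfolding cantor_set_def by blast
  then obtain t where t: "\<And>i. i < k \<Longrightarrow> t i \<in> {0..<1}" "\<And>i. i < k \<Longrightarrow> b i = point (t i)" by metis
  have k1: "1 < k" using k \<epsilon> by linarith
  obtain \<Delta> where "0 < \<Delta>" "(real k - 1 - 2 * \<epsilon>) * \<Delta> \<le> b (k - 1) - b 0"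
    using approx_AP_steps[OF b(1)] k1 \<epsilon> by (metis gr0I not_one_less_zero)
  \<comment> \<open>The positive span separates the end parameters and so supplies the starting
    scale \<open>n\<close>.\<close>
  then have "b 0 < b (k - 1)" using k mult_pos_pos[of "real k - 1 - 2 * \<epsilon>" \<Delta>] by linarith
  then have "t 0 \<noteq> t (k - 1)" using t k1 by auto
  then obtain n where "(1 / 2) ^ n < \<bar>t 0 - t (k - 1)\<bar>"
    using real_arch_pow_inv[of "\<bar>t 0 - t (k - 1)\<bar>" "1 / 2"] by auto
  with b(1) t show False
  proof (induction n arbitrary: t b)
    case 0
    then have "t 0 \<in> {0..<1}" "t (k - 1) \<in> {0..<1}" using k1 by auto
    then show ?case using 0(4) by auto
  next
    case (Suc n)
    show ?case
    \<comment> \<open>Testing neighbours is enough: if they always agree, all terms share a half;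
      otherwise a single step crosses the central gap.\<close>
    proof (cases "\<forall>i. Suc i < k \<longrightarrow> (t i < 1 / 2 \<longleftrightarrow> t (Suc i) < 1 / 2)")
      case True
      have half: "t i < 1 / 2 \<longleftrightarrow> t 0 < 1 / 2" if "i < k" for i
        using that True by (induction i) auto
      \<comment> \<open>The common first binary digit, so that one formula inverts either
        similarity.\<close>
      define e :: real where "e = (if t 0 < 1 / 2 then 0 else 1)"
      have b_eq: "b i = (1 - \<rho>) * e + \<rho> * point (2 * t i - e)" if "i < k" for i
        using half[OF that] Suc.prems(2,3)[OF that] point_low[of "t i"] point_high[of "t i"]
        by (auto simp: e_def)
      have "approx_AP k \<epsilon> (\<lambda>i. point (2 * t i - e))"
        by (rule approx_AP_affine[OF Suc.prems(1) \<rho>_pos]) (rule b_eq)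
      moreover have "2 * t i - e \<in> {0..<1}" if "i < k" for i
        using half[OF that] Suc.prems(2)[OF that] by (auto simp: e_def)
      moreover have "(1 / 2) ^ n < \<bar>(2 * t 0 - e) - (2 * t (k - 1) - e)\<bar>"
        using Suc.prems(4) by (simp add: abs_if split: if_splits)
      ultimately show ?thesis by (intro Suc.IH[of "\<lambda>i. point (2 * t i - e)" "\<lambda>i. 2 * t i - e"]) auto
    next
      case False
      then obtain i where i: "Suc i < k" "\<not> (t i < 1 / 2 \<longleftrightarrow> t (Suc i) < 1 / 2)" by blast
      obtain \<Delta> where \<Delta>: "\<And>i. Suc i < k \<Longrightarrow> \<bar>b (Suc i) - b i\<bar> \<le> (1 + 2 * \<epsilon>) * \<Delta>"
          "(real k - 1 - 2 * \<epsilon>) * \<Delta> \<le> b (k - 1) - b 0"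
        using approx_AP_steps[OF Suc.prems(1)] k1 \<epsilon> by (metis gr0I not_one_less_zero)
      \<comment> \<open>The strict bound reflects the removal of the right endpoints.\<close>
      have "b (k - 1) < 1" "0 \<le> b 0"
        using Suc.prems(2,3)[of "k - 1"] Suc.prems(3)[of 0] k1 point_less_1[of "t (k - 1)"] point_nonneg[of "t 0"]
        by auto
      then have "(1 + 2 * \<epsilon>) * ((real k - 1 - 2 * \<epsilon>) * \<Delta>) < (1 + 2 * \<epsilon>) * 1"
        using \<Delta>(2) \<epsilon> by (intro mult_strict_left_mono) auto
      also have "\<dots> \<le> (1 - 2 * \<rho>) * (real k - 1 - 2 * \<epsilon>)" using gap by simp
      finally have "((1 + 2 * \<epsilon>) * \<Delta>) * (real k - 1 - 2 * \<epsilon>) < (1 - 2 * \<rho>) * (real k - 1 - 2 * \<epsilon>)"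
        by (simp only: mult_ac)
      then have "(1 + 2 * \<epsilon>) * \<Delta> < 1 - 2 * \<rho>"
        using k by (simp add: mult_less_cancel_right)
      moreover have "1 - 2 * \<rho> < \<bar>b (Suc i) - b i\<bar>"
        using gap_less[of "t (Suc i)" "t i"] i Suc.prems(2,3) by auto
      ultimately show ?thesis using \<Delta>(1)[OF i(1)] by linarith
    qed
  qed
qed

end

theorem theorem2p2:
  fixes k :: nat and \<epsilon> :: real
  assumes "k \<ge> 3"
    and "0 < \<epsilon>" and "\<epsilon> < 1"
    and "\<epsilon> < (real k - 2) / 4"
  shows "\<exists>F :: real set.
           \<not> contains_approx_AP F k \<epsilon> \<and>
           assouad_dim F = hausdorff_dim F \<and>
           hausdorff_dim F =
             ereal (ln 2 / ln ((2 * real k - 2 - 4 * \<epsilon>) / (real k - 2 - 4 * \<epsilon>)))"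
proof -
  \<comment> \<open>The ratio is \<open>p / q\<close>, so that \<open>ln (1 / \<rho>)\<close> is the
    required denominator. The upper bound on \<open>\<epsilon>\<close> by
    \<open>(real k - 2) / 4\<close> says that \<open>p\<close> is positive, and
    \<open>q - 2 * p = 2 * (1 + 2 * \<epsilon>)\<close> makes the gap condition an equality.\<close>
  define p q where "p = real k - 2 - 4 * \<epsilon>" and "q = 2 * real k - 2 - 4 * \<epsilon>"
  have pq: "0 < p" "2 * p < q" using assms by (auto simp: p_def q_def)
  interpret cantor_ratio "p / q"
    using pq by unfold_locales (auto simp: field_simps)
  have "1 - 2 * (p / q) = (q - 2 * p) / q" using pq by (simp add: field_simps)
  also have "\<dots> = (1 + 2 * \<epsilon>) * 2 / q" by (simp add: p_def q_def)
  finally have "1 - 2 * (p / q) = (1 + 2 * \<epsilon>) * 2 / q" .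
  moreover have "real k - 1 - 2 * \<epsilon> = q / 2" by (simp add: q_def)
  ultimately have "(1 - 2 * (p / q)) * (real k - 1 - 2 * \<epsilon>) = (1 + 2 * \<epsilon>) * 2 / q * (q / 2)"
    by (simp only:)
  also have "\<dots> = 1 + 2 * \<epsilon>" using pq by simp
  finally have "1 + 2 * \<epsilon> = (1 - 2 * (p / q)) * (real k - 1 - 2 * \<epsilon>)" by (rule sym)
  then have "\<not> contains_approx_AP cantor_set k \<epsilon>"
    using assms by (intro no_approx_AP) auto
  moreover have "sim_dim = ln 2 / ln (q / p)" by (simp add: sim_dim_def)
  ultimately show ?thesis
    using assouad_dim_cantor_set hausdorff_dim_cantor_set unfolding p_def q_def by metis
qed

end
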